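(* Let $S$ be a set of $n$ points in general position in the plane. For every constant $c<1$ and every integer $3\leq k\leq c\cdot n$, $S$ contains $\Omega(n^2)$ $k$-holes.
   Context: A point set in the plane is in general position if no three of its points are collinear. A $k$-gon of $S$ is a simple polygon whose vertex set consists of exactly $k$ points of $S$ (distinct simple polygons on the same vertex set count separately), and a $k$-hole is a $k$-gon (convex or non-convex) whose interior contains no point of $S$. The constant in the $\Omega$-notation depends only on $c$. *)

theory Defs
  imports "HOL-Analysis.Analysis"
begin

text \<open>The Euclidean plane is the type \<^typ>\<open>complex\<close>, as in the library's Jordan curve theorem.\<close>

definition general_position :: "complex set \<Rightarrow> bool" where
  "general_position S \<longleftrightarrow> (\<forall>T\<subseteq>S. card T = 3 \<longrightarrow> \<not> collinear T)"

text \<open>A list \<open>vs\<close> of points stands for the closed polygonal chain through \<open>vs\<close> in cyclic order.\<close>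

definition polygon_edge :: "complex list \<Rightarrow> nat \<Rightarrow> complex set" where
  "polygon_edge vs i = closed_segment (vs ! i) (vs ! (Suc i mod length vs))"

definition polygon_boundary :: "complex list \<Rightarrow> complex set" where
  "polygon_boundary vs = (\<Union>i<length vs. polygon_edge vs i)"

text \<open>
  Two different edges meet only in the endpoints they share: consecutive edges in their common
  vertex, all other pairs not at all.
\<close>

definition simple_polygon :: "complex list \<Rightarrow> bool" where
  "simple_polygon vs \<longleftrightarrow> length vs \<ge> 3 \<and> distinct vs \<and>
     (\<forall>i<length vs. \<forall>j<length vs. i \<noteq> j \<longrightarrow>
        polygon_edge vs i \<inter> polygon_edge vs j =
        {vs ! i, vs ! (Suc i mod length vs)} \<inter> {vs ! j, vs ! (Suc j mod length vs)})"

text \<open>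
  A polygon is identified with its boundary curve, so that rotating or reversing the vertex list
  gives the same polygon. If no three points of \<open>S\<close> are collinear, the vertices are the corners
  of the boundary curve; the curve then determines the vertex list up to these operations, and
  different simple polygons on the same vertex set are different elements of \<open>k_gons S k\<close>.
\<close>

definition k_gons :: "complex set \<Rightarrow> nat \<Rightarrow> complex set set" where
  "k_gons S k = {polygon_boundary vs | vs. simple_polygon vs \<and> length vs = k \<and> set vs \<subseteq> S}"

text \<open>
  The interior of a polygon is the bounded component \<^term>\<open>inside P\<close> of the complement of its
  boundary \<open>P\<close> (not the topological \<^term>\<open>interior P\<close>, which is empty).
\<close>

definition k_holes :: "complex set \<Rightarrow> nat \<Rightarrow> complex set set" where
  "k_holes S k = {P \<in> k_gons S k. inside P \<inter> S = {}}"

end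

theory Submission
  imports Defs
begin

text \<open>
  Order \<open>S\<close> by a linear functional that is injective on it. Let \<open>a\<close>, \<open>b\<close> be two points with at
  least \<open>k - 2\<close> points of \<open>S\<close> between them in this order. Among the points in between take the
  \<open>k - 2\<close> closest to the line \<open>ab\<close>, join those above the line to a monotone chain from \<open>a\<close> to
  \<open>b\<close>, and those below it to a monotone chain back. The two chains form a simple polygon,
  contained in the parallelogram bounded by the lines through \<open>a\<close> and \<open>b\<close> on which the functional is
  constant and by the parallels to \<open>ab\<close> at the distance of the farthest chosen point. No point of
  \<open>S\<close> other than the vertices lies in the interior of this parallelogram, so the polygon is a
  \<open>k\<close>-hole. Its first and last points are \<open>a\<close> and \<open>b\<close>, so different pairs give different holes,
  and there are at least \<open>((n - k) / 2)\<^sup>2\<close> such pairs.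
\<close>

section \<open>Generic directions, sorting and selection in finite sets\<close>

text \<open>Two distinct points get equal values in the direction \<open>Complex 1 t\<close> for at
  most one \<open>t\<close>, the quotient in \<open>?B\<close>, so any real outside this finite set
  works.\<close>

lemma finite_generic_direction:
  fixes S :: "complex set"
  assumes "finite S"
  obtains u :: complex where "inj_on (\<lambda>z. u \<bullet> z) S"
proof -
  let ?B = "(\<lambda>(p, q). (Re q - Re p) / (Im p - Im q)) ` (S \<times> S)"
  have "finite ?B" using assms by simp
  then obtain t :: real where t: "t \<notin> ?B"
    using ex_new_if_finite infinite_UNIV_char_0 by blast
  have "inj_on (\<lambda>z. Complex 1 t \<bullet> z) S"
  proof (rule inj_onI)
    fix p q assume pq: "p \<in> S" "q \<in> S" "Complex 1 t \<bullet> p = Complex 1 t \<bullet> q"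
    then have e: "t * (Im p - Im q) = Re q - Re p"
      by (simp add: inner_complex_def algebra_simps)
    show "p = q"
    proof (cases "Im p = Im q")
      case True
      then show ?thesis using e by (simp add: complex_eq_iff)
    next
      case False
      then have "t = (Re q - Re p) / (Im p - Im q)" using e by (simp add: field_simps)
      then have "t \<in> ?B" using pq(1,2) by force
      then show ?thesis using t by simp
    qed
  qed
  then show ?thesis by (rule that)
qed

lemma finite_sorted_by:
  fixes f :: "'a \<Rightarrow> 'b::linorder"
  assumes "finite S" "inj_on f S"
  obtains xs where "set xs = S" "sorted_wrt (\<lambda>x y. f x < f y) xs" "length xs = card S"
proof -
  let ?ys = "sorted_list_of_set (f ` S)"
  let ?xs = "map (the_inv_into S f) ?ys"
  have set_ys: "set ?ys = f ` S" using assms(1) by simp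
  have "set ?xs = S"
    using the_inv_into_onto[OF assms(2)] set_ys by simp
  moreover have "sorted_wrt (\<lambda>x y. f x < f y) ?xs"
    unfolding sorted_wrt_map
    by (rule sorted_wrt_mono_rel[of _ "(<)"])
      (use set_ys f_the_inv_into_f[OF assms(2)] in auto)
  moreover have "length ?xs = card S"
    by (simp add: card_image assms(2))
  ultimately show ?thesis by (rule that)
qed

text \<open>Induction on \<open>m\<close>, each time adding a minimiser of \<open>h\<close> among
  the remaining points; ties are broken arbitrarily.\<close>

lemma finite_smallest_subset:
  fixes h :: "'a \<Rightarrow> 'b::linorder"
  assumes "finite T" "m \<le> card T"
  obtains Q where "Q \<subseteq> T" "card Q = m" "\<And>x y. x \<in> Q \<Longrightarrow> y \<in> T - Q \<Longrightarrow> h x \<le> h y"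
proof -
  have "\<exists>Q\<subseteq>T. card Q = m \<and> (\<forall>x\<in>Q. \<forall>y\<in>T - Q. h x \<le> h y)"
    using assms(2)
  proof (induction m)
    case 0
    then show ?case by (intro exI[of _ "{}"]) simp
  next
    case (Suc m)
    then obtain Q where Q: "Q \<subseteq> T" "card Q = m" "\<forall>x\<in>Q. \<forall>y\<in>T - Q. h x \<le> h y" by auto
    have fQ: "finite Q" using Q(1) assms(1) finite_subset by blast
    have "T - Q \<noteq> {}"
    proof
      assume "T - Q = {}"
      then have "Q = T" using Q(1) by blast
      then show False using Q(2) Suc.prems by simp
    qed
    then obtain x where x: "x \<in> T - Q" "\<forall>y\<in>T - Q. h x \<le> h y"
      using ex_min_if_finite[of "h ` (T - Q)"] assms(1)
      by (metis (mono_tags, lifting) arg_min_if_finite(1) arg_min_least finite_Diff)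
    show ?case
      by (intro exI[of _ "insert x Q"]) (use x Q fQ in auto)
  qed
  then show ?thesis using that by blast
qed

lemma less_chain:
  fixes h :: "nat \<Rightarrow> 'a::order"
  assumes "\<And>i. a \<le> i \<Longrightarrow> i < b \<Longrightarrow> h i < h (Suc i)" "a \<le> i" "i < j" "j \<le> b"
  shows "h i < h j"
  using assms(3,4)
proof (induction j)
  case 0
  then show ?case by simp
next
  case (Suc j)
  show ?case
  proof (cases "i = j")
    case True
    then show ?thesis using assms(1,2) Suc.prems by simp
  next
    case False
    then have "h i < h j" using Suc by simp
    also have "h j < h (Suc j)" using assms(1,2) Suc.prems by simp
    finally show ?thesis .
  qed
qed

section \<open>Segments, half-planes and monotone chains\<close>

lemma closed_segment_halfspace:
  fixes u z :: "'a::real_inner"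
  assumes "z \<in> closed_segment p q" "u \<bullet> p \<le> d" "u \<bullet> q \<le> d"
  shows "u \<bullet> z \<le> d"
proof -
  have "closed_segment p q \<subseteq> {z. u \<bullet> z \<le> d}"
    by (rule closed_segment_subset) (use assms convex_halfspace_le in auto)
  then show ?thesis using assms(1) by auto
qed

text \<open>At a parameter strictly between 0 and 1 the value at \<open>z\<close> is a strict
  average of two different values, so it cannot dominate both.\<close>

lemma closed_segment_halfspace_eq:
  fixes u z :: "'a::real_inner"
  assumes "z \<in> closed_segment p q" "u \<bullet> p \<le> u \<bullet> z" "u \<bullet> q \<le> u \<bullet> z" "u \<bullet> p \<noteq> u \<bullet> q"
  shows "z = p \<or> z = q"
proof -
  obtain t where t: "z = (1 - t) *\<^sub>R p + t *\<^sub>R q" "0 \<le> t" "t \<le> 1"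
    using assms(1) by (auto simp: in_segment)
  have z: "u \<bullet> z = (1 - t) * (u \<bullet> p) + t * (u \<bullet> q)"
    using t(1) by (simp add: inner_add_right)
  have "t * (u \<bullet> q - u \<bullet> p) \<ge> 0" "(1 - t) * (u \<bullet> p - u \<bullet> q) \<ge> 0"
    using assms(2,3) z by (simp_all add: algebra_simps)
  then have "t = 0 \<or> t = 1"
    using assms(4) t(2,3) by (auto simp: zero_le_mult_iff)
  then show ?thesis using t(1) by auto
qed

text \<open>Under \<open>u\<close> the edges project to consecutive intervals, which share at most
  an endpoint; there \<open>u\<close> is maximal on the earlier edge, so \<open>z\<close> is a
  vertex.\<close>

lemma monotone_chain_edges:
  fixes u z :: complex
  assumes inc: "\<And>i. a \<le> i \<Longrightarrow> i < b \<Longrightarrow> u \<bullet> v i < u \<bullet> v (Suc i)"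
    and ij: "a \<le> i" "i < j" "j < b"
    and z: "z \<in> closed_segment (v i) (v (Suc i))" "z \<in> closed_segment (v j) (v (Suc j))"
  shows "Suc i = j \<and> z = v j"
proof -
  have i: "u \<bullet> v i < u \<bullet> v (Suc i)" using inc ij by simp
  have j: "u \<bullet> v j < u \<bullet> v (Suc j)" using inc ij by simp
  have 1: "u \<bullet> z \<le> u \<bullet> v (Suc i)"
    using closed_segment_halfspace[OF z(1), of u] i by simp
  have 2: "u \<bullet> v j \<le> u \<bullet> z"
    using closed_segment_halfspace[OF z(2), of "-u" "- (u \<bullet> v j)"] j by simp
  have "\<not> Suc i < j"
  proof
    assume "Suc i < j"
    then have "u \<bullet> v (Suc i) < u \<bullet> v j"
      using less_chain[of a b "\<lambda>i. u \<bullet> v i"] inc ij by simp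
    then show False using 1 2 by simp
  qed
  then have s: "Suc i = j" using ij by simp
  have "z = v i \<or> z = v (Suc i)"
    by (rule closed_segment_halfspace_eq[OF z(1), of u]) (use i 2 s in auto)
  then show ?thesis using s i 2 by auto
qed

section \<open>Simplicity of a polygon made of two monotone chains\<close>

text \<open>Repeating the first vertex as \<open>v k\<close> makes the closing edge an ordinary one,
  which avoids indices modulo \<open>k\<close>.\<close>

lemma polygon_edge_map:
  assumes "v k = v 0" "i < k"
  shows "polygon_edge (map v [0..<k]) i = closed_segment (v i) (v (Suc i))"
proof (cases "Suc i = k")
  case True
  have "0 < k" using assms(2) by simp
  then show ?thesis using True assms unfolding polygon_edge_def by simp
next
  case False
  then show ?thesis using assms unfolding polygon_edge_def by simp
qed

text \<open>
  A chain without inner vertices (\<open>m = 1\<close> or \<open>k = m + 1\<close>) is the segment between \<open>v 0\<close> and \<open>v m\<close>.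
  As \<open>3 \<le> k\<close>, this happens for at most one of the two chains, and the other one then meets the
  line \<open>w \<bullet> z = d\<close> only in \<open>v 0\<close> and \<open>v m\<close>.
\<close>
lemma simple_polygon_two_chains:
  fixes u w :: complex
  assumes k: "3 \<le> k" "0 < m" "m < k" "v k = v 0"
    and inc: "\<And>i. i < m \<Longrightarrow> u \<bullet> v i < u \<bullet> v (Suc i)"
    and dec: "\<And>i. m \<le> i \<Longrightarrow> i < k \<Longrightarrow> u \<bullet> v (Suc i) < u \<bullet> v i"
    and above: "\<And>i. 0 < i \<Longrightarrow> i < m \<Longrightarrow> w \<bullet> v i > d"
    and below: "\<And>i. m < i \<Longrightarrow> i < k \<Longrightarrow> w \<bullet> v i < d"
    and ends: "w \<bullet> v 0 = d" "w \<bullet> v m = d"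
  shows "simple_polygon (map v [0..<k])"
proof -
  have inc': "u \<bullet> v i < u \<bullet> v j" if "i < j" "j \<le> m" for i j
    using less_chain[of 0 m "\<lambda>i. u \<bullet> v i" i j] inc that by simp
  have dec': "u \<bullet> v j < u \<bullet> v i" if "m \<le> i" "i < j" "j \<le> k" for i j
    using less_chain[of m k "\<lambda>i. - (u \<bullet> v i)" i j] dec that by simp
  have neq: "v i \<noteq> v j" if "i < j" "j < k" for i j
  proof -
    \<comment> \<open>On one chain \<open>u\<close> separates the vertices, on different chains
      \<open>w\<close> does; only \<open>v 0\<close> needs to be compared with \<open>v j\<close> as
      the end \<open>v k\<close> of the decreasing chain.\<close>
    consider "j \<le> m" | "m \<le> i" | "i < m" "m < j" "i = 0" | "i < m" "m < j" "i > 0" using that by linarith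
    then show ?thesis
    proof cases
      case 1
      then show ?thesis using inc'[of i j] that by auto
    next
      case 2
      then show ?thesis using dec'[of i j] that by auto
    next
      case 3
      then show ?thesis using dec'[of j k] that k(4) by auto
    next
      case 4
      then show ?thesis using above[of i] below[of j] that by auto
    qed
  qed
  have lo: "u \<bullet> v 0 \<le> u \<bullet> v i" and hi: "u \<bullet> v i \<le> u \<bullet> v m" if "i \<le> k" for i
  proof -
    show "u \<bullet> v 0 \<le> u \<bullet> v i"
    proof (cases "i \<le> m")
      case True
      then show ?thesis using inc'[of 0 i] by (cases "i = 0") auto
    next
      case False
      then show ?thesis using dec'[of i k] that k(4) by (cases "i = k") auto
    qed
    show "u \<bullet> v i \<le> u \<bullet> v m"
    proof (cases "i \<le> m")
      case True
      then show ?thesis using inc'[of i m] by (cases "i = m") auto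
    next
      case False
      then show ?thesis using dec'[of m i] that by auto
    qed
  qed
  have wi: "w \<bullet> v i \<ge> d" if "i \<le> m" for i
    using above[of i] ends that by (cases "i = 0"; cases "i = m") auto
  have wj: "w \<bullet> v i \<le> d" if "m \<le> i" "i \<le> k" for i
    using below[of i] ends that k(4) by (cases "i = k"; cases "i = m") auto
  have step: "u \<bullet> v i \<noteq> u \<bullet> v (Suc i)" if "i < k" for i
    using inc[of i] dec[of i] that by (cases "i < m") auto
  \<comment> \<open>Over the whole polygon \<open>u\<close> is minimal at \<open>v 0\<close> and
    maximal at \<open>v m\<close>, so neither can be an inner point of an edge.\<close>
  have extreme: "z = v i \<or> z = v (Suc i)"
    if "i < k" "z \<in> closed_segment (v i) (v (Suc i))" "z = v 0 \<or> z = v m" for i z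
    using that(3)
  proof
    assume "z = v m"
    then show ?thesis
      using closed_segment_halfspace_eq[OF that(2), of u] hi[of i] hi[of "Suc i"] step that by auto
  next
    assume "z = v 0"
    then show ?thesis
      using closed_segment_halfspace_eq[OF that(2), of "-u"] lo[of i] lo[of "Suc i"] step that by auto
  qed
  have common: "(z = v i \<or> z = v (Suc i)) \<and> (z = v j \<or> z = v (Suc j))"
    if ij: "i < j" "j < k" and z: "z \<in> closed_segment (v i) (v (Suc i))"
      "z \<in> closed_segment (v j) (v (Suc j))" for i j z
  proof -
    consider "j < m" | "m \<le> i" | "i < m" "m \<le> j" by linarith
    then show ?thesis
    proof cases
      case 1
      then show ?thesis using monotone_chain_edges[of 0 m u v i j z] inc ij z by auto
    next
      case 2
      then show ?thesis using monotone_chain_edges[of m k "-u" v i j z] dec ij z by auto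
    next
      case 3
      \<comment> \<open>The edges belong to different chains, one weakly above and one weakly below
        the line with value \<open>d\<close>, so a common point lies on this line.\<close>
      have "w \<bullet> z \<le> d"
        using closed_segment_halfspace[OF z(2), of w d] wj 3 ij by simp
      moreover have "w \<bullet> z \<ge> d"
        using closed_segment_halfspace[OF z(1), of "-w" "-d"] wi 3 by simp
      ultimately have wz: "w \<bullet> z = d" by simp
      have "z = v 0 \<or> z = v m"
      proof (cases "m = 1")
        case True
        \<comment> \<open>The upper chain is a single edge, so \<open>3 \<le> k\<close> gives the
          lower chain an inner vertex, and edge \<open>j\<close> has an endpoint strictly below the
          line.\<close>
        then have m2: "m < j \<or> Suc j < k" using k 3 by auto
        have ne: "w \<bullet> v j \<noteq> w \<bullet> v (Suc j)"
          if "\<not> (w \<bullet> v j < d \<and> w \<bullet> v (Suc j) < d)"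
          using that m2 below[of j] below[of "Suc j"] ends k(4) 3 ij
          by (cases "j = m"; cases "Suc j = k") auto
        show ?thesis
        proof (cases "w \<bullet> v j < d \<and> w \<bullet> v (Suc j) < d")
          case True
          define e where "e = max (w \<bullet> v j) (w \<bullet> v (Suc j))"
          have "w \<bullet> z \<le> e" by (rule closed_segment_halfspace[OF z(2)]) (auto simp: e_def)
          then show ?thesis using True wz by (auto simp: e_def)
        next
          case False
          have "z = v j \<or> z = v (Suc j)"
            by (rule closed_segment_halfspace_eq[OF z(2), of w]) (use wj 3 ij wz ne False in auto)
          then show ?thesis
            using below[of j] below[of "Suc j"] wz 3 ij k(4)
            by (cases "j = m"; cases "Suc j = k") auto
        qed
      next
        case m1: False
        \<comment> \<open>Now the upper chain has an inner vertex, so edge \<open>i\<close> has an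
          endpoint strictly above the line and can meet the line only in its other endpoint.\<close>
        show ?thesis
        proof (cases "w \<bullet> v i > d \<and> w \<bullet> v (Suc i) > d")
          case True
          define e where "e = min (w \<bullet> v i) (w \<bullet> v (Suc i))"
          have "- w \<bullet> z \<le> - e" by (rule closed_segment_halfspace[OF z(1)]) (auto simp: e_def)
          then show ?thesis using True wz by (auto simp: e_def)
        next
          case False
          have ne: "w \<bullet> v i \<noteq> w \<bullet> v (Suc i)"
            using False m1 k(2) above[of i] above[of "Suc i"] ends 3
            by (cases "i = 0"; cases "Suc i = m") auto
          have "z = v i \<or> z = v (Suc i)"
            by (rule closed_segment_halfspace_eq[OF z(1), of "-w"]) (use wi 3 ij wz ne in auto)
          then show ?thesis
            using above[of i] above[of "Suc i"] wz 3
            by (cases "i = 0"; cases "Suc i = m") auto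
        qed
      qed
      then show ?thesis using extreme z ij by auto
    qed
  qed
  let ?vs = "map v [0..<k]"
  have nth_suc: "?vs ! (Suc i mod k) = v (Suc i)" if "i < k" for i
    using that k by (cases "Suc i = k") auto
  have "polygon_edge ?vs i \<inter> polygon_edge ?vs j =
      {?vs ! i, ?vs ! (Suc i mod k)} \<inter> {?vs ! j, ?vs ! (Suc j mod k)}"
    if ij: "i < k" "j < k" "i \<noteq> j" for i j
  proof -
    have "polygon_edge ?vs i \<inter> polygon_edge ?vs j = {v i, v (Suc i)} \<inter> {v j, v (Suc j)}"
      unfolding polygon_edge_map[of v k, OF k(4) ij(1)] polygon_edge_map[of v k, OF k(4) ij(2)]
      using common[of i j] common[of j i] ij by (cases "i < j") auto
    moreover have "?vs ! i = v i" "?vs ! j = v j" using ij by simp_all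
    ultimately show ?thesis using nth_suc[OF ij(1)] nth_suc[OF ij(2)] by (simp only:)
  qed
  moreover have "distinct ?vs"
    unfolding distinct_map using neq by (auto intro!: linorder_inj_onI')
  moreover have "length ?vs = k" by simp
  ultimately show ?thesis
    unfolding simple_polygon_def by - (intro conjI, simp add: k, assumption, simp)
qed

section \<open>Half-planes and the inside of a polygon\<close>

lemma closed_polygon_boundary: "closed (polygon_boundary vs)"
  unfolding polygon_boundary_def polygon_edge_def by (intro closed_UN) auto

lemma set_subset_polygon_boundary: "set vs \<subseteq> polygon_boundary vs"
  unfolding polygon_boundary_def polygon_edge_def by (force simp: in_set_conv_nth)

lemma polygon_boundary_halfspace:
  assumes "z \<in> polygon_boundary vs" "\<And>p. p \<in> set vs \<Longrightarrow> u \<bullet> p \<le> d"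
  shows "u \<bullet> z \<le> d"
proof -
  obtain i where i: "i < length vs" "z \<in> closed_segment (vs ! i) (vs ! (Suc i mod length vs))"
    using assms(1) unfolding polygon_boundary_def polygon_edge_def by auto
  then have "Suc i mod length vs < length vs" by (intro mod_less_divisor) auto
  then show ?thesis using closed_segment_halfspace[OF i(2)] assms(2) i(1) by simp
qed

text \<open>The closed half-plane bounded by the line through \<open>r\<close> contains the boundary
  and, being convex, the inside; the inside is open, so it avoids the bounding line.\<close>

lemma extreme_not_inside_polygon:
  assumes "u \<noteq> 0" "\<And>p. p \<in> set vs \<Longrightarrow> u \<bullet> p \<le> u \<bullet> r"
  shows "r \<notin> inside (polygon_boundary vs)"
proof
  assume r: "r \<in> inside (polygon_boundary vs)"
  have "inside (polygon_boundary vs) \<subseteq> {z. u \<bullet> z \<le> u \<bullet> r}"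
  proof -
    have "polygon_boundary vs \<subseteq> {z. u \<bullet> z \<le> u \<bullet> r}"
      using polygon_boundary_halfspace assms(2) by blast
    then show ?thesis using inside_mono inside_convex[OF convex_halfspace_le] by blast
  qed
  then have "inside (polygon_boundary vs) \<subseteq> interior {z. u \<bullet> z \<le> u \<bullet> r}"
    by (intro interior_maximal open_inside closed_polygon_boundary)
  then show False using r interior_halfspace_le[OF assms(1)] by auto
qed

section \<open>Normal vectors and general position\<close>

text \<open>Multiplication by \<open>\<i>\<close> rotates by a right angle, so
  \<open>\<i> * (b - a)\<close> is normal to the line \<open>ab\<close>.\<close>

lemma collinear_if_inner_perp:
  fixes a b p :: complex
  assumes "(\<i> * (b - a)) \<bullet> p = (\<i> * (b - a)) \<bullet> a" "a \<noteq> b"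
  shows "collinear {a, b, p}"
proof -
  have e: "(Re b - Re a) * (Im p - Im a) = (Im b - Im a) * (Re p - Re a)"
    using assms(1) by (simp add: inner_complex_def algebra_simps)
  have "\<exists>t. p - a = t *\<^sub>R (b - a)"
  proof (cases "Re b = Re a")
    case True
    then have im: "Im b \<noteq> Im a" using assms(2) by (auto simp: complex_eq_iff)
    then have "Re p = Re a" using e True by simp
    then show ?thesis using True im
      by (intro exI[of _ "(Im p - Im a) / (Im b - Im a)"]) (simp add: complex_eq_iff)
  next
    case False
    define t where "t = (Re p - Re a) / (Re b - Re a)"
    have "Re p - Re a = t * (Re b - Re a)" using False by (simp add: t_def)
    moreover from this have "(Re b - Re a) * (Im p - Im a) = (Re b - Re a) * (t * (Im b - Im a))"
      using e by (simp add: mult_ac)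
    then have "Im p - Im a = t * (Im b - Im a)" using False by simp
    ultimately show ?thesis by (intro exI[of _ t]) (simp add: complex_eq_iff)
  qed
  then have "collinear {0, b - a, p - a}" unfolding collinear_lemma by blast
  then show ?thesis using collinear_3[of b a p] by (simp add: insert_commute)
qed

lemma general_position_inner_perp:
  assumes "general_position S" "a \<in> S" "b \<in> S" "p \<in> S" "a \<noteq> b" "p \<noteq> a" "p \<noteq> b"
  shows "(\<i> * (b - a)) \<bullet> p \<noteq> (\<i> * (b - a)) \<bullet> a"
proof
  assume "(\<i> * (b - a)) \<bullet> p = (\<i> * (b - a)) \<bullet> a"
  then have "collinear {a, b, p}" using assms(5) by (rule collinear_if_inner_perp)
  moreover have "card {a, b, p} = 3" using assms by auto
  moreover have "{a, b, p} \<subseteq> S" using assms by simp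
  ultimately show False using assms(1) unfolding general_position_def by blast
qed

section \<open>The hole spanned by two points\<close>

text \<open>The bounds on \<open>u\<close> serve the counting: they allow \<open>a\<close> and
  \<open>b\<close> to be recovered from \<open>P\<close>.\<close>

lemma k_hole_between:
  assumes S: "finite S" "general_position S" and inj: "inj_on (\<lambda>z. u \<bullet> z) S"
    and ab: "a \<in> S" "b \<in> S" "u \<bullet> a < u \<bullet> b"
    and k: "3 \<le> k" "k \<le> card {p\<in>S. u \<bullet> a < u \<bullet> p \<and> u \<bullet> p < u \<bullet> b} + 2"
  obtains P where "P \<in> k_holes S k" "a \<in> P" "b \<in> P"
    "\<And>z. z \<in> P \<Longrightarrow> u \<bullet> a \<le> u \<bullet> z \<and> u \<bullet> z \<le> u \<bullet> b"
proof -
  define T where "T = {p\<in>S. u \<bullet> a < u \<bullet> p \<and> u \<bullet> p < u \<bullet> b}"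
  define w where "w = \<i> * (b - a)"
  define d where "d = w \<bullet> a"
  have u0: "u \<noteq> 0" using ab by auto
  have w0: "w \<noteq> 0" using ab by (auto simp: w_def)
  have wb: "w \<bullet> b = d" by (simp add: d_def w_def inner_complex_def algebra_simps)
  have wT: "w \<bullet> p < d \<or> d < w \<bullet> p" if "p \<in> T" for p
    unfolding d_def w_def neq_iff[symmetric]
    by (rule general_position_inner_perp[OF S(2)]) (use ab that in \<open>auto simp: T_def\<close>)
  have fT: "finite T" using S(1) by (simp add: T_def)
  \<comment> \<open>Since \<open>w\<close> is normal to the line \<open>ab\<close>,
    \<open>\<bar>w \<bullet> x - d\<bar>\<close> is the distance of \<open>x\<close> from this line,
    up to a factor common to all points.\<close>
  obtain Q where Q: "Q \<subseteq> T" "card Q = k - 2"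
    and near: "\<And>x y. x \<in> Q \<Longrightarrow> y \<in> T - Q \<Longrightarrow> \<bar>w \<bullet> x - d\<bar> \<le> \<bar>w \<bullet> y - d\<bar>"
  proof (rule finite_smallest_subset)
    show "finite T" by (rule fT)
    show "k - 2 \<le> card T" using k(2) by (simp add: T_def)
  qed (rule that)
  have fQ: "finite Q" using Q(1) fT finite_subset by blast
  define U where "U = {p\<in>Q. w \<bullet> p > d}"
  define L where "L = {p\<in>Q. w \<bullet> p < d}"
  have UL: "Q = U \<union> L" "U \<inter> L = {}" using wT Q(1) by (auto simp: U_def L_def)
  have fUL: "finite U" "finite L" using fQ by (auto simp: U_def L_def)
  have QS: "Q \<subseteq> S" using Q(1) by (auto simp: T_def)
  have injUL: "inj_on (\<lambda>z. u \<bullet> z) U" "inj_on (\<lambda>z. - (u \<bullet> z)) L"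
    using inj QS by (auto simp: inj_on_def U_def L_def)
  obtain us where us: "set us = U" "sorted_wrt (\<lambda>x y. u \<bullet> x < u \<bullet> y) us" "length us = card U"
    using finite_sorted_by[OF fUL(1) injUL(1)] by blast
  \<comment> \<open>The lower chain runs back from \<open>b\<close> to \<open>a\<close>, hence the
    negated functional.\<close>
  obtain ls where ls: "set ls = L" "sorted_wrt (\<lambda>x y. - (u \<bullet> x) < - (u \<bullet> y)) ls" "length ls = card L"
    using finite_sorted_by[OF fUL(2) injUL(2)] by blast
  define A where "A = a # us @ [b]"
  define B where "B = b # ls @ [a]"
  define m where "m = Suc (length us)"
  \<comment> \<open>The lists overlap in \<open>b\<close> at index \<open>m\<close>, and the last
    entry of \<open>B\<close> is \<open>a\<close>, which gives \<open>v k = v 0\<close>.\<close>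
  define v where "v i = (if i \<le> m then A ! i else B ! (i - m))" for i
  have "card Q = length us + length ls"
    using us ls UL fUL by (simp add: card_Un_disjoint)
  then have km: "k = Suc (m + length ls)" using Q(2) k(1) by (simp add: m_def)
  have lenA: "length A = Suc m" by (simp add: A_def m_def)
  have lenB: "length B = Suc (k - m)" by (simp add: B_def km)
  have sA: "sorted_wrt (\<lambda>x y. u \<bullet> x < u \<bullet> y) A"
    using us Q(1) ab(3) by (auto simp: A_def sorted_wrt_append U_def T_def)
  have sB: "sorted_wrt (\<lambda>x y. - (u \<bullet> x) < - (u \<bullet> y)) B"
    using ls Q(1) ab(3) by (auto simp: B_def sorted_wrt_append L_def T_def)
  have vB: "v i = B ! (i - m)" if "m \<le> i" for i
    using that by (auto simp: v_def A_def B_def m_def nth_append)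
  have v0: "v 0 = a" by (simp add: v_def A_def)
  have vm: "v m = b" using vB[of m] by (simp add: B_def)
  have vk: "v k = a" using vB[of k] by (simp add: km B_def nth_append)
  have vU: "v i \<in> U" if "0 < i" "i < m" for i
  proof -
    have "v i = us ! (i - 1)" using that by (cases i) (simp_all add: v_def A_def m_def nth_append)
    then show ?thesis using that us(1) nth_mem[of "i - 1" us] by (simp add: m_def)
  qed
  have vL: "v i \<in> L" if "m < i" "i < k" for i
  proof -
    have "v i = ls ! (i - m - 1)" using that by (auto simp: vB B_def km nth_append nth_Cons')
    then show ?thesis using that ls(1) nth_mem[of "i - m - 1" ls] by (simp add: km)
  qed
  let ?vs = "map v [0..<k]"
  have simple: "simple_polygon ?vs"
  proof (rule simple_polygon_two_chains[where m = m and u = u and w = w and d = d])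
    show "u \<bullet> v i < u \<bullet> v (Suc i)" if "i < m" for i
      using sorted_wrt_nth_less[OF sA, of i "Suc i"] that lenA by (simp add: v_def)
    show "u \<bullet> v (Suc i) < u \<bullet> v i" if "m \<le> i" "i < k" for i
      using sorted_wrt_nth_less[OF sB, of "i - m" "Suc i - m"] that lenB by (simp add: vB)
    show "w \<bullet> v i > d" if "0 < i" "i < m" for i using vU[OF that] by (simp add: U_def)
    show "w \<bullet> v i < d" if "m < i" "i < k" for i using vL[OF that] by (simp add: L_def)
  qed (use k v0 vm vk wb in \<open>auto simp: km m_def d_def\<close>)
  have vs_sub: "set ?vs \<subseteq> insert a (insert b Q)"
  proof
    fix p assume "p \<in> set ?vs"
    then obtain i where i: "i < k" "p = v i" by auto
    then consider "i = 0" | "0 < i" "i < m" | "i = m" | "m < i" by linarith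
    then show "p \<in> insert a (insert b Q)"
      by cases (use i v0 vm vU vL UL in auto)
  qed
  \<comment> \<open>Equal cardinalities turn the inclusion into an equality, so every chosen point
    is a vertex.\<close>
  have "card (set ?vs) = k" using simple by (simp only: distinct_card simple_polygon_def length_map) simp
  moreover have "card (insert a (insert b Q)) = k"
  proof -
    have "a \<notin> Q" "b \<notin> Q" "a \<noteq> b" using Q(1) ab(3) by (auto simp: T_def)
    then show ?thesis using fQ Q(2) k(1) by simp
  qed
  ultimately have vs_eq: "set ?vs = insert a (insert b Q)"
    using vs_sub fQ by (intro card_subset_eq) auto
  define P where "P = polygon_boundary ?vs"
  have vsP: "insert a (insert b Q) \<subseteq> P"
    using set_subset_polygon_boundary[of ?vs] unfolding vs_eq P_def .
  have range: "u \<bullet> a \<le> u \<bullet> p \<and> u \<bullet> p \<le> u \<bullet> b" if "p \<in> set ?vs" for p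
    using that Q(1) ab(3) unfolding vs_eq by (auto simp: T_def)
  have "P \<in> k_gons S k"
    unfolding k_gons_def P_def mem_Collect_eq
    by (rule exI[of _ ?vs], intro conjI refl simple) (use vs_eq QS ab in auto)
  moreover have "r \<notin> inside P" if r: "r \<in> S" for r
  proof -
    consider "u \<bullet> r \<le> u \<bullet> a" | "u \<bullet> b \<le> u \<bullet> r" | "r \<in> Q" | "r \<in> T - Q"
      using r unfolding T_def by fastforce
    then show ?thesis
    proof cases
      case 1
      then show ?thesis unfolding P_def
        using range u0 by (intro extreme_not_inside_polygon[of "-u"]) fastforce+
    next
      case 2
      then show ?thesis unfolding P_def
        using range u0 by (intro extreme_not_inside_polygon[of u]) fastforce+
    next
      case 3
      then show ?thesis using vsP inside_no_overlap[of P] by blast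
    next
      case 4
      \<comment> \<open>No vertex is farther from the line \<open>ab\<close> than the unchosen point
        \<open>r\<close>, so \<open>r\<close> is extreme in the direction \<open>w\<close> or
        \<open>-w\<close>, whichever points to its side.\<close>
      have le: "\<bar>w \<bullet> p - d\<bar> \<le> \<bar>w \<bullet> r - d\<bar>" if "p \<in> set ?vs" for p
        using that near[OF _ 4] wb unfolding vs_eq by (auto simp: d_def)
      show ?thesis
      proof (cases "w \<bullet> r \<ge> d")
        case True
        then show ?thesis unfolding P_def
          using le w0 by (intro extreme_not_inside_polygon[of w]) fastforce+
      next
        case False
        then show ?thesis unfolding P_def
          using le w0 by (intro extreme_not_inside_polygon[of "-w"]) fastforce+
      qed
    qed
  qed
  ultimately have "P \<in> k_holes S k" unfolding k_holes_def by auto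
  moreover have "u \<bullet> a \<le> u \<bullet> z \<and> u \<bullet> z \<le> u \<bullet> b" if "z \<in> P" for z
    using polygon_boundary_halfspace[of z ?vs "-u" "- (u \<bullet> a)"]
      polygon_boundary_halfspace[of z ?vs u "u \<bullet> b"] range that unfolding P_def by auto
  ultimately show ?thesis using that vsP by blast
qed

section \<open>Counting the holes\<close>

lemma finite_k_holes:
  assumes "finite S"
  shows "finite (k_holes S k)"
proof (rule finite_subset)
  show "k_holes S k \<subseteq> polygon_boundary ` {vs. set vs \<subseteq> S \<and> length vs = k}"
    unfolding k_holes_def k_gons_def by auto
  show "finite (polygon_boundary ` {vs. set vs \<subseteq> S \<and> length vs = k})"
    using finite_lists_length_eq[OF assms] by simp
qed

lemma card_k_holes_ge:
  assumes S: "finite S" "general_position S" and k: "3 \<le> k" "k \<le> card S"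
  shows "(Suc ((card S - k) div 2))\<^sup>2 \<le> card (k_holes S k)"
proof -
  obtain u where inj: "inj_on (\<lambda>z. u \<bullet> z) S" using finite_generic_direction[OF S(1)] .
  obtain xs where xs: "set xs = S" "sorted_wrt (\<lambda>x y. u \<bullet> x < u \<bullet> y) xs" "length xs = card S"
    using finite_sorted_by[OF S(1) inj] .
  define n where "n = card S"
  define h where "h = Suc ((n - k) div 2)"
  have less: "u \<bullet> (xs ! i) < u \<bullet> (xs ! j)" if "i < j" "j < n" for i j
    using sorted_wrt_nth_less[OF xs(2)] that xs(3) n_def by simp
  have inS: "xs ! i \<in> S" if "i < n" for i using that xs n_def nth_mem by metis
  have inj_nth: "i = j" if "xs ! i = xs ! j" "i < n" "j < n" for i j
    using less[of i j] less[of j i] that by (cases i j rule: linorder_cases) auto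
  \<comment> \<open>The condition \<open>i + k \<le> Suc j\<close> says that the
    \<open>j - i - 1\<close> points strictly between number at least \<open>k - 2\<close>.\<close>
  have "\<exists>P\<in>k_holes S k. xs ! i \<in> P \<and> xs ! j \<in> P \<and>
      (\<forall>z\<in>P. u \<bullet> (xs ! i) \<le> u \<bullet> z \<and> u \<bullet> z \<le> u \<bullet> (xs ! j))"
    if ij: "i + k \<le> Suc j" "j < n" for i j
  proof -
    have "i < j" using ij k by simp
    have "(\<lambda>l. xs ! l) ` {i<..<j} \<subseteq> {p\<in>S. u \<bullet> (xs ! i) < u \<bullet> p \<and> u \<bullet> p < u \<bullet> (xs ! j)}"
      using less inS ij by auto
    then have "card ((\<lambda>l. xs ! l) ` {i<..<j})
        \<le> card {p\<in>S. u \<bullet> (xs ! i) < u \<bullet> p \<and> u \<bullet> p < u \<bullet> (xs ! j)}"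
      using S(1) by (intro card_mono) auto
    moreover have "card ((\<lambda>l. xs ! l) ` {i<..<j}) = j - i - 1"
      using inj_nth ij by (subst card_image) (auto simp: inj_on_def)
    ultimately have c: "k \<le> card {p\<in>S. u \<bullet> (xs ! i) < u \<bullet> p \<and> u \<bullet> p < u \<bullet> (xs ! j)} + 2"
      using ij by simp
    have "xs ! i \<in> S" "xs ! j \<in> S" "u \<bullet> (xs ! i) < u \<bullet> (xs ! j)"
      using inS less \<open>i < j\<close> ij(2) by simp_all
    from k_hole_between[OF S inj this k(1) c] obtain P where
      "P \<in> k_holes S k" "xs ! i \<in> P" "xs ! j \<in> P"
      "\<And>z. z \<in> P \<Longrightarrow> u \<bullet> (xs ! i) \<le> u \<bullet> z \<and> u \<bullet> z \<le> u \<bullet> (xs ! j)"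
      by metis
    then show ?thesis by (intro bexI[of _ P] conjI ballI) simp_all
  qed
  then obtain H where H: "\<And>i j. i + k \<le> Suc j \<Longrightarrow> j < n \<Longrightarrow> H i j \<in> k_holes S k \<and>
      xs ! i \<in> H i j \<and> xs ! j \<in> H i j \<and>
      (\<forall>z\<in>H i j. u \<bullet> (xs ! i) \<le> u \<bullet> z \<and> u \<bullet> z \<le> u \<bullet> (xs ! j))"
    by metis
  txt \<open>The pairs \<open>(i, j) = (s, n - 1 - t)\<close> with \<open>s, t \<le> (n - k) / 2\<close> satisfy \<open>k \<le> j - i + 1\<close>.\<close>
  define F where "F = (\<lambda>(s, t). H s (n - Suc t))"
  have ok: "s + k \<le> Suc (n - Suc t) \<and> n - Suc t < n \<and> s < n \<and> t < n" if "s < h" "t < h" for s t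
    using that k unfolding h_def n_def by linarith
  have "inj_on F ({..<h} \<times> {..<h})"
  proof (rule inj_onI)
    fix x y assume xy: "x \<in> {..<h} \<times> {..<h}" "y \<in> {..<h} \<times> {..<h}" "F x = F y"
    obtain s t s' t' where xy_eq: "x = (s, t)" "y = (s', t')" by (cases x; cases y)
    then have st: "s < h" "t < h" "s' < h" "t' < h" and eq: "F (s, t) = F (s', t')"
      using xy by auto
    have o: "s + k \<le> Suc (n - Suc t)" "n - Suc t < n" "s < n" "t < n"
       "s' + k \<le> Suc (n - Suc t')" "n - Suc t' < n" "s' < n" "t' < n"
      using ok[of s t] ok[of s' t'] st by auto
    note H1 = H[OF o(1,2)] and H2 = H[OF o(5,6)]
    \<comment> \<open>Equal holes have the same minimum and the same maximum of \<open>u\<close>,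
      attained at their first and last points.\<close>
    have "u \<bullet> (xs ! s) = u \<bullet> (xs ! s')" "u \<bullet> (xs ! (n - Suc t)) = u \<bullet> (xs ! (n - Suc t'))"
      using H1 H2 eq by (auto simp: F_def intro!: antisym)
    then have "xs ! s = xs ! s'" "xs ! (n - Suc t) = xs ! (n - Suc t')"
      using inS o by (auto intro: inj_onD[OF inj])
    then have "s = s'" "n - Suc t = n - Suc t'" using inj_nth o by auto
    \<comment> \<open>As \<open>t\<close> and \<open>t'\<close> are below \<open>n\<close>, the
      subtractions are not truncated and determine them.\<close>
    then show "x = y" using o xy_eq by simp
  qed
  moreover have "F ` ({..<h} \<times> {..<h}) \<subseteq> k_holes S k"
    using H ok by (auto simp: F_def)
  ultimately have "card ({..<h} \<times> {..<h}) \<le> card (k_holes S k)"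
    using finite_k_holes[OF S(1)] by (rule card_inj_on_le)
  then show ?thesis by (simp add: h_def n_def power2_eq_square)
qed

theorem theorem5:
  fixes c :: real
  assumes "c < 1"
  shows "\<exists>C>0. \<exists>n0::nat. \<forall>n\<ge>n0. \<forall>(S::complex set) (k::nat).
           finite S \<and> card S = n \<and> general_position S \<and> 3 \<le> k \<and> real k \<le> c * real n \<longrightarrow>
           real (card (k_holes S k)) \<ge> C * (real n)\<^sup>2"
proof (intro exI[of _ "((1 - c) / 2)\<^sup>2"] conjI exI[of _ "0::nat"] allI impI)
  \<comment> \<open>The constant comes from \<open>(n - k) / 2 \<ge> (1 - c) / 2 * n\<close>, a
    lower bound on the choices for each end. The \<open>Suc\<close> in the count absorbs the
    rounding of \<open>div\<close>, so the threshold 0 suffices.\<close>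
  show "0 < ((1 - c) / 2)\<^sup>2" using assms by simp
next
  fix n k :: nat and S :: "complex set"
  assume A: "finite S \<and> card S = n \<and> general_position S \<and> 3 \<le> k \<and> real k \<le> c * real n"
  have "c * real n \<le> 1 * real n" using assms by (intro mult_right_mono) auto
  then have kn: "k \<le> n" using A by linarith
  have "(1 - c) / 2 * real n \<le> real (n - k) / 2"
    using A kn by (simp add: of_nat_diff left_diff_distrib)
  also have "\<dots> \<le> real (Suc ((n - k) div 2))" by linarith
  finally have "((1 - c) / 2 * real n)\<^sup>2 \<le> (real (Suc ((n - k) div 2)))\<^sup>2"
    using assms by (intro power_mono) auto
  also have "\<dots> \<le> real (card (k_holes S k))"
    using card_k_holes_ge[of S k] A kn by (metis of_nat_le_iff of_nat_power)
  finally show "((1 - c) / 2)\<^sup>2 * (real n)\<^sup>2 \<le> real (card (k_holes S k))"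
    by (simp only: power_mult_distrib)
qed

end
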